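(* For every finite simple graph $\Gamma$ there exists a finite abelian group $G$ such that $\Gamma$ is isomorphic to an induced subgraph of the difference graph $D(G)$.
   Context: For a group $G$, the power graph $\mathsf{Pow}(G)$ has vertex set $G$, with distinct $a,b$ adjacent iff $a\in\langle b\rangle$ or $b\in\langle a\rangle$. The enhanced power graph $\mathsf{EPow}(G)$ has vertex set $G$, with distinct $a,b$ adjacent iff $\langle a,b\rangle$ is cyclic. The difference graph $D(G)$ is the graph $\mathsf{EPow}(G)-\mathsf{Pow}(G)$ (vertex set $G$, edges those of $\mathsf{EPow}(G)$ that are not edges of $\mathsf{Pow}(G)$) with all isolated vertices removed. Thus $x\sim y$ in $D(G)$ iff $\langle x,y\rangle$ is cyclic, $x\notin\langle y\rangle$ and $y\notin\langle x\rangle$. *)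

theory Defs
  imports
    "HOL-Algebra.Elementary_Groups"
    "Graph_Theory.Pair_Digraph"
    "Graph_Theory.Digraph_Isomorphism"
begin

text \<open>
  As in the theory of \<^locale>\<open>graph\<close>, an undirected graph is a symmetric digraph: an edge between
  distinct \<^term>\<open>a\<close> and \<^term>\<open>b\<close> is represented by the two arcs \<^term>\<open>(a, b)\<close> and \<^term>\<open>(b, a)\<close>.
\<close>

definition power_graph :: "('a, 'b) monoid_scheme \<Rightarrow> 'a pair_pre_digraph" where
  "power_graph G =
    \<lparr> pverts = carrier G,
      parcs = {(a, b). a \<in> carrier G \<and> b \<in> carrier G \<and> a \<noteq> b \<and>
                 (a \<in> generate G {b} \<or> b \<in> generate G {a})} \<rparr>"

definition enhanced_power_graph :: "('a, 'b) monoid_scheme \<Rightarrow> 'a pair_pre_digraph" where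
  "enhanced_power_graph G =
    \<lparr> pverts = carrier G,
      parcs = {(a, b). a \<in> carrier G \<and> b \<in> carrier G \<and> a \<noteq> b \<and>
                 cyclic_group (subgroup_generated G {a, b})} \<rparr>"

definition remove_isolated :: "'a pair_pre_digraph \<Rightarrow> 'a pair_pre_digraph" where
  "remove_isolated X =
    \<lparr> pverts = {v \<in> pverts X. \<exists>w. (v, w) \<in> parcs X \<or> (w, v) \<in> parcs X},
      parcs = parcs X \<rparr>"

definition difference_graph :: "('a, 'b) monoid_scheme \<Rightarrow> 'a pair_pre_digraph" where
  "difference_graph G = remove_isolated
    \<lparr> pverts = carrier G,
      parcs = parcs (enhanced_power_graph G) - parcs (power_graph G) \<rparr>"

lemma difference_graph_adj_iff:
  assumes "group G" "x \<in> carrier G" "y \<in> carrier G"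
  shows "(x, y) \<in> parcs (difference_graph G) \<longleftrightarrow>
    cyclic_group (subgroup_generated G {x, y}) \<and> x \<notin> generate G {y} \<and> y \<notin> generate G {x}"
  using assms
  by (auto simp: difference_graph_def remove_isolated_def enhanced_power_graph_def
      power_graph_def intro: generate.incl)

lemma pair_graph_difference_graph:
  assumes "finite (carrier G)"
  shows "pair_graph (difference_graph G)"
proof -
  have *: "parcs (difference_graph G) \<subseteq> carrier G \<times> carrier G"
    by (auto simp: difference_graph_def remove_isolated_def enhanced_power_graph_def)
  show ?thesis
  proof unfold_locales
    show "finite (pverts (difference_graph G))"
      using assms by (simp add: difference_graph_def remove_isolated_def)
    show "finite (parcs (difference_graph G))"
      using assms * by (meson finite_SigmaI finite_subset)
  qed (auto simp: difference_graph_def remove_isolated_def enhanced_power_graph_def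
      power_graph_def symmetric_def sym_def insert_commute)
qed

end

theory Submission
  imports
    Defs
    "HOL-Algebra.Product_Groups"
    "HOL-Algebra.Multiplicative_Group"
    "HOL-Algebra.Weak_Morphisms"
    "HOL-Computational_Algebra.Primes"
begin

text \<open>
  In a direct sum of cyclic groups \<open>\<int>/m\<^sub>v\<close>, the generators of two different summands generate a
  subgroup isomorphic to \<open>\<int>/m\<^sub>u \<times> \<int>/m\<^sub>v\<close>, which is cyclic exactly when \<open>m\<^sub>u\<close> and \<open>m\<^sub>v\<close> are coprime.
  So it suffices to choose the orders \<open>m\<^sub>v > 1\<close> such that coprimality is adjacency: assign distinct
  primes to the non-edges \<open>{u, v}\<close> (with \<open>u = v\<close> allowed), and let \<open>m\<^sub>v\<close> be the product of the primes of
  the non-edges at \<open>v\<close>. An additional vertex joined to all others keeps the vertices of the given graph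
  from being isolated in \<open>EPow(G) - Pow(G)\<close>.
\<close>

section \<open>Cyclic subgroups generated by two independent elements\<close>

text \<open>Powers in the generated subgroup agree with powers in \<open>G\<close>, so its cyclic
  subgroups are sets \<open>generate G {z}\<close>. These always lie in \<open>generate G S\<close>;
  only the reverse inclusion is a condition, and it can be tested on \<open>S\<close>.\<close>

lemma (in group) cyclic_subgroup_generated_iff:
  assumes "S \<subseteq> carrier G"
  shows "cyclic_group (subgroup_generated G S) \<longleftrightarrow> (\<exists>z \<in> generate G S. S \<subseteq> generate G {z})"
proof -
  interpret S: group "subgroup_generated G S"
    by simp
  have car: "carrier (subgroup_generated G S) = generate G S"
    using assms by (simp add: carrier_subgroup_generated Int_absorb1)
  have "generate G S = range (\<lambda>n::int. z [^]\<^bsub>subgroup_generated G S\<^esub> n) \<longleftrightarrow> S \<subseteq> generate G {z}"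
    if z: "z \<in> generate G S" for z
  proof -
    have zG: "z \<in> carrier G"
      using z assms generate_in_carrier by blast
    have "range (\<lambda>n::int. z [^]\<^bsub>subgroup_generated G S\<^esub> n) = generate G {z}"
      using z by (auto simp: generate_pow[OF zG] int_pow_subgroup_generated car)
    moreover have "generate G {z} \<subseteq> generate G S"
      using z assms by (simp add: generate_is_subgroup generate_subgroup_incl)
    moreover have "S \<subseteq> generate G {z} \<Longrightarrow> generate G S \<subseteq> generate G {z}"
      using zG by (simp add: generate_is_subgroup generate_subgroup_incl)
    ultimately show ?thesis
      using generate.incl[of _ S G] by auto
  qed
  then show ?thesis
    by (auto simp: S.cyclic_group car)
qed

text \<open>By commutativity the product of two subgroups is a subgroup. This is used to write a
  common generator as a power of \<open>x\<close> times a power of \<open>y\<close>.\<close>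

lemma (in comm_group) generate_insert_subset:
  assumes "x \<in> carrier G" "y \<in> carrier G"
  shows "generate G {x, y} \<subseteq> generate G {x} <#> generate G {y}"
proof (rule generate_subgroup_incl)
  have x: "subgroup (generate G {x}) G" and y: "subgroup (generate G {y}) G"
    using assms by (simp_all add: generate_is_subgroup)
  have "x \<otimes> \<one> \<in> generate G {x} <#> generate G {y}" "\<one> \<otimes> y \<in> generate G {x} <#> generate G {y}"
    unfolding set_mult_def by (blast intro: generate.intros)+
  then show "{x, y} \<subseteq> generate G {x} <#> generate G {y}"
    using assms by simp
  show "subgroup (generate G {x} <#> generate G {y}) G"
    by (rule mult_subgroups[OF x y])
qed

text \<open>The hypothesis \<open>indep\<close> packs three facts into one equation:
  \<open>x\<close> has order \<open>m\<close> (take \<open>l = 0\<close>), \<open>y\<close> has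
  order \<open>n\<close> (take \<open>k = 0\<close>), and their cyclic subgroups meet trivially.
  Finiteness allows natural exponents throughout.\<close>

lemma (in comm_group) independent_cyclic_iff_coprime:
  fixes m n :: nat
  assumes fin: "finite (carrier G)" and x: "x \<in> carrier G" and y: "y \<in> carrier G"
    and indep: "\<And>k l::nat. x [^] k = y [^] l \<longleftrightarrow> m dvd k \<and> n dvd l"
    and "m > 1" "n > 1"
  shows "cyclic_group (subgroup_generated G {x, y}) \<longleftrightarrow> coprime m n"
proof -
  have xm: "x [^] k = \<one> \<longleftrightarrow> m dvd k" for k :: nat
    using indep[of k 0] by simp
  have yn: "y [^] k = \<one> \<longleftrightarrow> n dvd k" for k :: nat
    using indep[of 0 k] by (simp add: eq_commute[of \<one>])
  have "coprime m n" if z: "z \<in> generate G {x, y}" and xz: "x \<in> generate G {z}" and yz: "y \<in> generate G {z}" for z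
  proof -
    have zG: "z \<in> carrier G"
      using z x y generate_in_carrier[of "{x, y}" z] by simp
    obtain a b :: nat where a: "x = z [^] a" and b: "y = z [^] b"
      using xz yz by (auto simp: generate_pow_on_finite_carrier[OF fin zG])
    have "z \<in> generate G {x} <#> generate G {y}"
      using z generate_insert_subset[OF x y] by blast
    then obtain i j :: nat where "z = x [^] i \<otimes> y [^] j"
      by (auto simp: set_mult_def generate_pow_on_finite_carrier[OF fin] x y)
    then have zij: "z = z [^] (a * i + b * j)"
      using a b zG by (simp add: nat_pow_pow nat_pow_mult)
    \<comment> \<open>Both sides are \<open>z [^] (a * b)\<close>. Independence then puts the gcd
      \<open>d\<close> into both \<open>a\<close> and \<open>b\<close>, hence into the exponent that
      fixes \<open>z\<close>.\<close>
    have "x [^] b = y [^] a"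
      unfolding a b using zG by (simp add: nat_pow_pow mult.commute)
    then have "m dvd b" "n dvd a"
      using indep by auto
    define d where "d = gcd m n"
    have "d dvd a * i + b * j"
      using \<open>m dvd b\<close> \<open>n dvd a\<close> unfolding d_def by (meson dvd_add dvd_mult2 dvd_trans gcd_dvd1 gcd_dvd2)
    then obtain c where c: "a * i + b * j = d * c" ..
    obtain m' where m': "m = d * m'"
      unfolding d_def using gcd_dvd1 by (metis dvdE)
    \<comment> \<open>Replacing \<open>z\<close> by the equal element \<open>z [^] (d * c)\<close>
      supplies the factor \<open>d\<close> missing from \<open>m'\<close>, so the power becomes one
      of \<open>x [^] m\<close>, which is trivial. The order \<open>m = d * m'\<close> therefore
      divides \<open>m'\<close>.\<close>
    have "x [^] m' = (z [^] (d * c)) [^] (a * m')"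
      using a c zij zG by (metis nat_pow_pow)
    also have "\<dots> = x [^] (m * c)"
      using a zG by (simp add: m' nat_pow_pow ac_simps)
    also have "\<dots> = \<one>"
      by (simp add: xm)
    finally have "m dvd m'"
      by (simp add: xm)
    moreover have "m' > 0"
      using m' \<open>m > 1\<close> by (cases m') auto
    ultimately have "d = 1"
      using m' \<open>m > 1\<close> by (metis dvd_antisym dvd_triv_right mult_cancel2 mult_1 not_gr_zero)
    then show ?thesis
      by (simp add: d_def coprime_iff_gcd_eq_1)
  qed
  moreover have "\<exists>z \<in> generate G {x, y}. x \<in> generate G {z} \<and> y \<in> generate G {z}" if "coprime m n"
  proof
    \<comment> \<open>The exponent \<open>n * a\<close> is 0 modulo \<open>n\<close> and 1 modulo
      \<open>m\<close>, so raising \<open>x \<otimes> y\<close> to it removes \<open>y\<close> and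
      keeps \<open>x\<close>; \<open>m * a'\<close> does the opposite.\<close>
    obtain a b where ab: "n * a = m * b + 1"
      using coprime_bezout_strong[of n m] \<open>coprime m n\<close> \<open>m > 1\<close> by (auto simp: coprime_commute)
    obtain a' b' where ab': "m * a' = n * b' + 1"
      using coprime_bezout_strong[of m n] \<open>coprime m n\<close> \<open>n > 1\<close> by auto
    have "(x \<otimes> y) [^] (n * a) = x [^] (m * b + 1) \<otimes> y [^] (n * a)"
      by (simp only: pow_mult_distrib[OF m_comm[OF x y] x y] flip: ab)
    also have "\<dots> = x"
      using x y xm[of "m * b"] yn[of "n * a"] by (simp flip: nat_pow_mult)
    finally have "x = (x \<otimes> y) [^] (n * a)" ..
    moreover have "(x \<otimes> y) [^] (m * a') = x [^] (m * a') \<otimes> y [^] (n * b' + 1)"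
      by (simp only: pow_mult_distrib[OF m_comm[OF x y] x y] flip: ab')
    then have "y = (x \<otimes> y) [^] (m * a')"
      using x y xm[of "m * a'"] yn[of "n * b'"] by (simp flip: nat_pow_mult)
    ultimately show "x \<in> generate G {x \<otimes> y} \<and> y \<in> generate G {x \<otimes> y}"
      using x y by (auto simp: generate_pow_on_finite_carrier[OF fin])
    show "x \<otimes> y \<in> generate G {x, y}"
      by (intro generate.eng generate.incl) auto
  qed
  ultimately show ?thesis
    using x y by (auto simp: cyclic_subgroup_generated_iff)
qed

text \<open>Neither element is a power of the other, since independence with exponent 1 would give
  \<open>m dvd 1\<close> or \<open>n dvd 1\<close>. Adjacency thus reduces to cyclicity.\<close>

lemma (in comm_group) independent_difference_graph_adj_iff:
  fixes m n :: nat
  assumes fin: "finite (carrier G)" and x: "x \<in> carrier G" and y: "y \<in> carrier G"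
    and indep: "\<And>k l::nat. x [^] k = y [^] l \<longleftrightarrow> m dvd k \<and> n dvd l"
    and "m > 1" "n > 1"
  shows "(x, y) \<in> parcs (difference_graph G) \<longleftrightarrow> coprime m n"
proof -
  have "x \<noteq> y [^] k" "y \<noteq> x [^] k" for k :: nat
    using indep[of 1 k] indep[of k 1] x y \<open>m > 1\<close> \<open>n > 1\<close> by auto
  then have "x \<notin> generate G {y}" "y \<notin> generate G {x}"
    by (auto simp: generate_pow_on_finite_carrier[OF fin] x y)
  then show ?thesis
    using difference_graph_adj_iff[OF is_group x y] independent_cyclic_iff_coprime[OF assms] by simp
qed

section \<open>Independent elements of prescribed orders\<close>

lemma (in comm_group) comm_group_image_group:
  assumes "inj_on f (carrier G)"
  shows "comm_group (image_group f G)"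
  by (rule comm_groupI)
    (use assms in \<open>auto simp: image_group_def m_ac intro!: bexI[of _ "inv _"]\<close>)

lemma hom_image_group:
  assumes "inj_on f (carrier G)"
  shows "f \<in> hom G (image_group f G)"
  using assms by (auto simp: hom_def image_group_def)

lemma nat_pow_product_group:
  "x [^]\<^bsub>product_group I G\<^esub> (k::nat) = (\<lambda>i\<in>I. x i [^]\<^bsub>G i\<^esub> k)"
  by (induction k) auto

lemma exists_independent_elements:
  fixes I :: "'i set" and m :: "'i \<Rightarrow> nat"
  assumes "finite I" and m: "\<And>i. i \<in> I \<Longrightarrow> m i > 1"
  obtains G :: "nat monoid" and x :: "'i \<Rightarrow> nat"
  where "comm_group G" "finite (carrier G)" "x ` I \<subseteq> carrier G"
    "\<And>i j k l. \<lbrakk>i \<in> I; j \<in> I; i \<noteq> j\<rbrakk> \<Longrightarrow>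
       x i [^]\<^bsub>G\<^esub> (k::nat) = x j [^]\<^bsub>G\<^esub> (l::nat) \<longleftrightarrow> m i dvd k \<and> m j dvd l"
proof -
  define P where "P = product_group I (\<lambda>i. integer_mod_group (m i))"
  have "comm_group P"
    unfolding P_def by (rule group.group_comm_groupI) (auto simp: add.commute intro!: restrict_ext)
  interpret P: comm_group P by fact
  have "finite (carrier P)"
    using \<open>finite I\<close> gr_implies_not0[OF m] unfolding P_def
    by (auto simp: carrier_integer_mod_group intro!: finite_PiE)
  \<comment> \<open>The product consists of functions; being finite, it can be copied along an
    injection to a group whose elements are natural numbers.\<close>
  then obtain f :: "('i \<Rightarrow> int) \<Rightarrow> nat" where f: "inj_on f (carrier P)"
    using finite_imp_inj_to_nat_seg by blast
  let ?G = "image_group f P"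
  have G: "comm_group ?G"
    using f by (rule P.comm_group_image_group)
  then have "group ?G"
    by (rule comm_group.axioms)
  then interpret f: group_hom P ?G f
    using hom_image_group[OF f] by (simp add: group_hom_def group_hom_axioms_def P.is_group)
  \<comment> \<open>These are the unit vectors. The entry 1 is a legal residue because no modulus
    equals 1. Multiples of two different unit vectors agree only if both vanish, as coordinates
    \<open>i\<close> and \<open>j\<close> show.\<close>
  define e where "e i = (\<lambda>j\<in>I. if j = i then 1 else 0 :: int)" for i
  have e: "e i \<in> carrier P" for i
    using less_imp_neq[OF m, symmetric] by (auto simp: P_def e_def)
  have e_pow: "e i [^]\<^bsub>P\<^esub> k = (\<lambda>j\<in>I. if j = i then int k mod int (m i) else 0)" for i and k :: nat
    unfolding P_def nat_pow_product_group
    by (rule restrict_ext) (simp add: e_def)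
  have e_indep: "e i [^]\<^bsub>P\<^esub> k = e j [^]\<^bsub>P\<^esub> l \<longleftrightarrow> m i dvd k \<and> m j dvd l"
    if "i \<in> I" "j \<in> I" "i \<noteq> j" for i j and k l :: nat
  proof -
    have "int k mod int (m i) = 0" "int l mod int (m j) = 0"
      if eq: "e i [^]\<^bsub>P\<^esub> k = e j [^]\<^bsub>P\<^esub> l"
      using fun_cong[OF eq, of i] fun_cong[OF eq, of j] \<open>i \<in> I\<close> \<open>j \<in> I\<close> \<open>i \<noteq> j\<close> by (simp_all add: e_pow)
    moreover have "e i [^]\<^bsub>P\<^esub> k = e j [^]\<^bsub>P\<^esub> l"
      if "int k mod int (m i) = 0" "int l mod int (m j) = 0"
      unfolding e_pow using that by (intro restrict_ext) simp
    moreover have "int k mod int (m i) = 0 \<longleftrightarrow> m i dvd k" "int l mod int (m j) = 0 \<longleftrightarrow> m j dvd l"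
      by (simp_all add: mod_eq_0_iff_dvd)
    ultimately show ?thesis
      by metis
  qed
  have "f (e i) [^]\<^bsub>?G\<^esub> k = f (e j) [^]\<^bsub>?G\<^esub> l \<longleftrightarrow> m i dvd k \<and> m j dvd l"
    if "i \<in> I" "j \<in> I" "i \<noteq> j" for i j and k l :: nat
    using e_indep[OF that] inj_on_eq_iff[OF f] e by (simp flip: f.hom_nat_pow)
  then show thesis
    using that[of ?G "f \<circ> e"] G \<open>finite (carrier P)\<close> e
    by (simp add: image_group_carrier image_subset_iff)
qed

section \<open>Every finite graph is a coprimality graph\<close>

lemma exists_coprimality_labelling:
  fixes I :: "'i set" and adj :: "'i \<Rightarrow> 'i \<Rightarrow> bool"
  assumes "finite I" and sym: "\<And>i j. adj i j \<Longrightarrow> adj j i" and irrefl: "\<And>i. \<not> adj i i"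
  obtains m :: "'i \<Rightarrow> nat"
  where "\<And>i. i \<in> I \<Longrightarrow> m i > 1"
    "\<And>i j. \<lbrakk>i \<in> I; j \<in> I\<rbrakk> \<Longrightarrow> coprime (m i) (m j) \<longleftrightarrow> adj i j"
proof -
  obtain p :: "nat \<Rightarrow> nat" where p: "inj p" "range p \<subseteq> {q. prime q}"
    using infinite_countable_subset[OF primes_infinite] by blast
  obtain c :: "'i set \<Rightarrow> nat" where c: "inj_on c (Pow I)"
    using finite_imp_inj_to_nat_seg[of "Pow I"] \<open>finite I\<close> by auto
  \<comment> \<open>Coding subsets of \<open>I\<close> by numbers and then by primes gives each
    unordered pair \<open>{i, j}\<close>, including \<open>{i, i}\<close>, its own prime.\<close>
  define q where "q = p \<circ> c"
  have prime_q: "prime (q S)" for S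
    using p by (auto simp: q_def)
  have q_eq_iff: "q S = q T \<longleftrightarrow> S = T" if "S \<subseteq> I" "T \<subseteq> I" for S T
    using that p(1) c by (auto simp: q_def inj_eq inj_on_eq_iff)
  \<comment> \<open>By irreflexivity \<open>i\<close> belongs to \<open>N i\<close>, so
    \<open>m i\<close> has at least the prime factor \<open>q {i, i}\<close>.\<close>
  define N where "N i = {j \<in> I. \<not> adj i j}" for i
  define m where "m i = (\<Prod>j \<in> N i. q {i, j})" for i
  have fin: "finite (N i)" for i
    using \<open>finite I\<close> by (simp add: N_def)
  have m_dvd: "q {i, j} dvd m i" if "j \<in> N i" for i j
    unfolding m_def using fin that by (rule dvd_prodI)
  have "m i > 1" if "i \<in> I" for i
  proof -
    have "m i > 0"
      using prime_q by (auto simp: m_def prime_gt_0_nat intro!: prod_pos)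
    moreover have "q {i, i} dvd m i"
      using that irrefl by (intro m_dvd) (simp add: N_def)
    ultimately show ?thesis
      by (meson dvd_imp_le less_le_trans prime_gt_1_nat prime_q)
  qed
  moreover have "coprime (m i) (m j) \<longleftrightarrow> adj i j" if ij: "i \<in> I" "j \<in> I" for i j
  proof
    assume cop: "coprime (m i) (m j)"
    show "adj i j"
    proof (rule ccontr)
      assume "\<not> adj i j"
      then have "j \<in> N i" "i \<in> N j"
        using ij sym by (auto simp: N_def)
      then have "q {i, j} dvd m i" "q {i, j} dvd m j"
        using m_dvd[of j i] m_dvd[of i j] by (simp_all add: insert_commute)
      then have "is_unit (q {i, j})"
        by (rule coprime_common_divisor[OF cop])
      then show False
        using prime_q by (metis not_prime_unit)
    qed
  next
    assume "adj i j"
    have "q {i, a} \<noteq> q {j, b}" if "a \<in> N i" "b \<in> N j" for a b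
    proof -
      \<comment> \<open>Adjacency gives \<open>i \<noteq> j\<close>, so equality would force
        \<open>a = j\<close>, contradicting \<open>a \<in> N i\<close>.\<close>
      have "{i, a} \<noteq> {j, b}"
        using that \<open>adj i j\<close> irrefl by (auto simp: N_def doubleton_eq_iff)
      then show ?thesis
        using that ij by (subst q_eq_iff) (auto simp: N_def)
    qed
    then show "coprime (m i) (m j)"
      unfolding m_def by (intro prod_coprime_left prod_coprime_right primes_coprime prime_q)
  qed
  ultimately show thesis
    by (rule that)
qed

section \<open>Embedding a graph into a difference graph\<close>

text \<open>The arcs of \<open>with_proj D\<close> are pairs of vertices, so each arc of
  \<open>\<Gamma>\<close> is sent to the pair of images of its ends. This is injective on arcs
  because \<open>\<Gamma>\<close> has no parallel arcs, and \<open>adj\<close> makes the image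
  subgraph induced.\<close>

lemma digraph_iso_induced_subgraphI:
  fixes D :: "'a pair_pre_digraph" and f :: "'v \<Rightarrow> 'a"
  assumes "nomulti_digraph \<Gamma>" "wf_digraph (with_proj D)"
    and inj: "inj_on f (verts \<Gamma>)" and verts: "f ` verts \<Gamma> \<subseteq> pverts D"
    and adj: "\<And>u v. \<lbrakk>u \<in> verts \<Gamma>; v \<in> verts \<Gamma>\<rbrakk> \<Longrightarrow> (f u, f v) \<in> parcs D \<longleftrightarrow> u \<rightarrow>\<^bsub>\<Gamma>\<^esub> v"
  shows "\<exists>H. induced_subgraph H (with_proj D) \<and> digraph_iso \<Gamma> H"
proof -
  interpret nomulti_digraph \<Gamma> by fact
  define h where "h = \<lparr>iso_verts = f, iso_arcs = (\<lambda>e. (f (tail \<Gamma> e), f (head \<Gamma> e))),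
    iso_head = snd, iso_tail = fst\<rparr>"
  have h: "digraph_isomorphism h"
    unfolding digraph_isomorphism_def
  proof (intro conjI)
    show "inj_on (iso_arcs h) (arcs \<Gamma>)"
      by (rule inj_onI, rule no_multi_arcs) (auto simp: h_def arc_to_ends_def dest: inj_onD[OF inj])
  qed (use inj in \<open>auto simp: h_def wf_digraph\<close>)
  have "arcs (app_iso h \<Gamma>) = {e \<in> parcs D. fst e \<in> f ` verts \<Gamma> \<and> snd e \<in> f ` verts \<Gamma>}"
    (is "?L = ?R")
  proof
    have "tail \<Gamma> e \<rightarrow>\<^bsub>\<Gamma>\<^esub> head \<Gamma> e" if "e \<in> arcs \<Gamma>" for e
      using that by (auto simp: arcs_ends_conv)
    then show "?L \<subseteq> ?R"
      using adj by (auto simp: h_def)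
    show "?R \<subseteq> ?L"
      using adj by (force simp: h_def arcs_ends_conv)
  qed
  then have "induced_subgraph (app_iso h \<Gamma>) (with_proj D)"
    using verts assms(2) wf_digraphI_app_iso[OF h]
    by (auto simp: induced_subgraph_def subgraph_def compatible_def h_def)
  then show ?thesis
    using h by (auto simp: digraph_iso_def)
qed

theorem theorem2p9:
  fixes \<Gamma> :: "('v, 'e) pre_digraph"
  assumes "graph \<Gamma>"
  shows "\<exists>(G :: nat monoid) H. comm_group G \<and> finite (carrier G) \<and>
    induced_subgraph H (with_proj (difference_graph G)) \<and> digraph_iso \<Gamma> H"
proof -
  interpret graph \<Gamma> by fact
  \<comment> \<open>\<open>None\<close> is the additional vertex, and \<open>adj\<close> joins it to
    every \<open>Some v\<close>.\<close>
  define I where "I = insert None (Some ` verts \<Gamma>)"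
  define adj where "adj i j \<longleftrightarrow>
    (case (i, j) of (Some u, Some v) \<Rightarrow> u \<rightarrow>\<^bsub>\<Gamma>\<^esub> v | (None, None) \<Rightarrow> False | _ \<Rightarrow> True)" for i j
  have "finite I"
    by (simp add: I_def)
  moreover have "adj j i" if "adj i j" for i j
    using that arcs_ends_symmetric[OF sym_arcs] by (auto simp: adj_def split: option.splits)
  moreover have irrefl: "\<not> adj i i" for i
    using adj_not_same by (auto simp: adj_def split: option.splits)
  ultimately obtain m :: "'v option \<Rightarrow> nat" where m: "\<And>i. i \<in> I \<Longrightarrow> m i > 1"
    and coprime_m: "\<And>i j. \<lbrakk>i \<in> I; j \<in> I\<rbrakk> \<Longrightarrow> coprime (m i) (m j) \<longleftrightarrow> adj i j"
    using exists_coprimality_labelling[of I adj] by blast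
  obtain G :: "nat monoid" and x :: "'v option \<Rightarrow> nat"
    where G: "comm_group G" "finite (carrier G)" and x: "x ` I \<subseteq> carrier G"
      and indep: "\<And>i j k l. \<lbrakk>i \<in> I; j \<in> I; i \<noteq> j\<rbrakk> \<Longrightarrow>
        x i [^]\<^bsub>G\<^esub> (k::nat) = x j [^]\<^bsub>G\<^esub> (l::nat) \<longleftrightarrow> m i dvd k \<and> m j dvd l"
    using exists_independent_elements[of I m] \<open>finite I\<close> m by blast
  interpret G: comm_group G by fact
  interpret D: pair_graph "difference_graph G"
    using G(2) by (rule pair_graph_difference_graph)
  have adj_iff: "(x i, x j) \<in> parcs (difference_graph G) \<longleftrightarrow> adj i j" if "i \<in> I" "j \<in> I" for i j
  proof (cases "i = j")
    \<comment> \<open>\<open>indep\<close> covers only distinct indices; on the diagonal both sides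
      are false.\<close>
    case True
    then show ?thesis
      using irrefl D.no_loops[of "(x i, x i)"] by auto
  next
    case False
    have "(x i, x j) \<in> parcs (difference_graph G) \<longleftrightarrow> coprime (m i) (m j)"
      using that x m False
      by (intro G.independent_difference_graph_adj_iff G(2)) (auto simp: indep)
    then show ?thesis
      using that by (simp add: coprime_m)
  qed
  have "inj_on x I"
  proof (rule inj_onI, rule ccontr)
    fix i j assume ij: "i \<in> I" "j \<in> I" "x i = x j" "i \<noteq> j"
    \<comment> \<open>Equal elements have equal first powers, so \<open>indep\<close> applies with
      both exponents 1.\<close>
    then have "m i dvd 1"
      using indep[of i j 1 1] by simp
    then show False
      using m[of i] ij by simp
  qed
  then have "inj_on (x \<circ> Some) (verts \<Gamma>)"
    by (auto simp: inj_on_def I_def)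
  moreover have "(x \<circ> Some) ` verts \<Gamma> \<subseteq> pverts (difference_graph G)"
  proof clarsimp
    fix v assume "v \<in> verts \<Gamma>"
    \<comment> \<open>The arc to the additional vertex shows that the image of \<open>v\<close>
      survives the removal of isolated vertices, even if \<open>v\<close> is isolated in
      \<open>\<Gamma>\<close>.\<close>
    then have "(x (Some v), x None) \<in> parcs (difference_graph G)"
      by (subst adj_iff) (auto simp: I_def adj_def)
    then show "x (Some v) \<in> pverts (difference_graph G)"
      by (rule D.arc_fst_in_verts[of "(_, _)", simplified])
  qed
  moreover have "((x \<circ> Some) u, (x \<circ> Some) v) \<in> parcs (difference_graph G) \<longleftrightarrow> u \<rightarrow>\<^bsub>\<Gamma>\<^esub> v"
    if "u \<in> verts \<Gamma>" "v \<in> verts \<Gamma>" for u v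
    using that adj_iff[of "Some u" "Some v"] by (simp add: I_def adj_def)
  ultimately show ?thesis
    using digraph_iso_induced_subgraphI[OF nomulti_digraph D.wf_digraph] G by blast
qed

end
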